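(* Let $\mathbb{k}$ be a field, $G$ a finite abelian group, and let $q_0,q_1: G\to\mathbb{k}^\times$ be weak quadratic forms symmetric with respect to $g_0,g_1\in G$ respectively, i.e. $q_0(g)=q_0(g^{-1}g_0)$ and $q_1(g)=q_1(g^{-1}g_1)$ for all $g\in G$. Assume $\beta_{q_0}=\beta_{q_1}$. Then there exists a character $\eta\in\mathrm{Hom}(G,\mathbb{k}^\times)$ such that $$q_0=q_1\cdot\eta.$$ In particular, if $g_0=g_1=1$, it follows that $\eta\in\mathrm{Hom}(G,\{\pm1\})$. Conversely, such a decomposition implies $\beta_{q_0}=\beta_{q_1}$.
   Context: For $q: G\to\mathbb{k}^\times$ put $\beta_q(g_1,g_2)=q(g_1g_2)q(g_1)^{-1}q(g_2)^{-1}$; $q$ is a weak quadratic form if $\beta_q: G\times G\to\mathbb{k}^\times$ is a bihomomorphism. *)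

theory Defs
  imports "HOL-Algebra.Ring"
begin

text \<open>
  The multiplicative group of a field \<open>K\<close> is \<open>units_of K\<close>. The codomain
  of the forms below is an arbitrary group \<open>A\<close>, to be instantiated with \<open>units_of K\<close>.
  Only the values of a function on \<open>carrier G\<close> are meaningful.
\<close>

definition polarization ::
  "('a, 'm) monoid_scheme \<Rightarrow> ('b, 'n) monoid_scheme \<Rightarrow> ('a \<Rightarrow> 'b) \<Rightarrow> 'a \<Rightarrow> 'a \<Rightarrow> 'b"
  where "polarization G A q g h =
    q (g \<otimes>\<^bsub>G\<^esub> h) \<otimes>\<^bsub>A\<^esub> inv\<^bsub>A\<^esub> (q g) \<otimes>\<^bsub>A\<^esub> inv\<^bsub>A\<^esub> (q h)"

definition bihomomorphism ::
  "('a, 'm) monoid_scheme \<Rightarrow> ('b, 'n) monoid_scheme \<Rightarrow> ('a \<Rightarrow> 'a \<Rightarrow> 'b) \<Rightarrow> bool"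
  where "bihomomorphism G A b \<longleftrightarrow>
    (\<forall>g \<in> carrier G. (\<lambda>h. b g h) \<in> hom G A) \<and>
    (\<forall>h \<in> carrier G. (\<lambda>g. b g h) \<in> hom G A)"

definition weak_quadratic_form ::
  "('a, 'm) monoid_scheme \<Rightarrow> ('b, 'n) monoid_scheme \<Rightarrow> ('a \<Rightarrow> 'b) \<Rightarrow> bool"
  where "weak_quadratic_form G A q \<longleftrightarrow>
    q \<in> carrier G \<rightarrow> carrier A \<and> bihomomorphism G A (polarization G A q)"

definition symmetric_wrt ::
  "('a, 'm) monoid_scheme \<Rightarrow> 'a \<Rightarrow> ('a \<Rightarrow> 'b) \<Rightarrow> bool"
  where "symmetric_wrt G g\<^sub>0 q \<longleftrightarrow>
    (\<forall>g \<in> carrier G. q g = q (inv\<^bsub>G\<^esub> g \<otimes>\<^bsub>G\<^esub> g\<^sub>0))"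

text \<open>The subgroup \<open>{1, -1}\<close> of the multiplicative group of \<open>K\<close>.\<close>

definition sign_group :: "('b, 'n) ring_scheme \<Rightarrow> 'b monoid"
  where "sign_group K = (units_of K)\<lparr>carrier := {\<one>\<^bsub>K\<^esub>, \<ominus>\<^bsub>K\<^esub> \<one>\<^bsub>K\<^esub>}\<rparr>"

end

theory Submission
  imports Defs
begin

text \<open>The polarization is the defect of multiplicativity: q(gh) = \<beta>_q(g,h) q(g) q(h). It
  sends pointwise products to products and is trivial exactly on homomorphisms, so two functions
  have the same polarization if and only if their quotient is a homomorphism. Hence \<eta> = q_0 /
  q_1 is the required character (\<open>quotient_hom_if_polarization_eq\<close>), and the converse
  is \<open>polarization_mult_hom\<close>. If g_0 = g_1 = 1, symmetry makes both forms, hence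
  \<eta>, invariant under inversion. Then \<eta>(g) = \<eta>(g)^{-1}, so \<eta>(g) is a square root
  of 1, which in a field means 1 or -1 (\<open>hom_sign_group\<close>). In the lemmas on commutative
  groups, \<open>G\<close> is the target, later \<open>units_of K\<close>, and \<open>H\<close> is
  the source.\<close>

lemma (in comm_group) inv_mult_cancel_factor:
  assumes "p \<in> carrier G" "a \<in> carrier G" "b \<in> carrier G"
  shows "(p \<otimes> a) \<otimes> inv (p \<otimes> b) = a \<otimes> inv b"
proof -
  have "(p \<otimes> a) \<otimes> inv (p \<otimes> b) = (p \<otimes> inv p) \<otimes> (a \<otimes> inv b)"
    using assms by (simp add: inv_mult m_ac)
  then show ?thesis
    using assms by simp
qed

text \<open>The definition solved for the value at the product; in this form the polarization is a
  factor that can be cancelled from a quotient.\<close>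

lemma (in comm_group) polarization_mult_cancel:
  fixes H (structure)
  assumes "q \<in> carrier H \<rightarrow> carrier G" "monoid H" "g \<in> carrier H" "h \<in> carrier H"
  shows "polarization H G q g h \<otimes> (q g \<otimes> q h) = q (g \<otimes>\<^bsub>H\<^esub> h)"
proof -
  have c: "q g \<in> carrier G" "q h \<in> carrier G" "q (g \<otimes>\<^bsub>H\<^esub> h) \<in> carrier G"
    using assms monoid.m_closed[OF assms(2-4)] by auto
  have "polarization H G q g h \<otimes> (q g \<otimes> q h)
      = q (g \<otimes>\<^bsub>H\<^esub> h) \<otimes> (inv (q g) \<otimes> q g) \<otimes> (inv (q h) \<otimes> q h)"
    unfolding polarization_def using c by (simp only: m_ac inv_closed m_closed)
  also have "\<dots> = q (g \<otimes>\<^bsub>H\<^esub> h)"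
    using c by simp
  finally show ?thesis .
qed

lemma (in comm_group) quotient_hom_if_polarization_eq:
  fixes H (structure)
  assumes q: "q \<in> carrier H \<rightarrow> carrier G" and r: "r \<in> carrier H \<rightarrow> carrier G"
    and H: "monoid H"
    and eq: "\<And>g h. g \<in> carrier H \<Longrightarrow> h \<in> carrier H \<Longrightarrow>
      polarization H G q g h = polarization H G r g h"
  shows "(\<lambda>g. q g \<otimes> inv (r g)) \<in> hom H G"
proof (rule homI)
  fix g h assume gh: "g \<in> carrier H" "h \<in> carrier H"
  have c: "q g \<in> carrier G" "q h \<in> carrier G" "r g \<in> carrier G" "r h \<in> carrier G"
      "r (g \<otimes>\<^bsub>H\<^esub> h) \<in> carrier G"
    using q r gh monoid.m_closed[OF H gh] by auto
  let ?p = "polarization H G r g h"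
  have p: "?p \<in> carrier G"
    using c by (simp add: polarization_def)
  \<comment> \<open>By \<open>eq\<close>, the same defect \<open>?p\<close> occurs in numerator and
    denominator, so it drops out and leaves the quotient of the products.\<close>
  have "q (g \<otimes>\<^bsub>H\<^esub> h) \<otimes> inv (r (g \<otimes>\<^bsub>H\<^esub> h))
      = (?p \<otimes> (q g \<otimes> q h)) \<otimes> inv (?p \<otimes> (r g \<otimes> r h))"
    using polarization_mult_cancel[OF q H gh] polarization_mult_cancel[OF r H gh] eq[OF gh]
    by simp
  also have "\<dots> = (q g \<otimes> q h) \<otimes> inv (r g \<otimes> r h)"
    using p c by (simp add: inv_mult_cancel_factor)
  also have "\<dots> = (q g \<otimes> inv (r g)) \<otimes> (q h \<otimes> inv (r h))"
    using c by (simp add: inv_mult m_ac)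
  finally show "q (g \<otimes>\<^bsub>H\<^esub> h) \<otimes> inv (r (g \<otimes>\<^bsub>H\<^esub> h))
      = (q g \<otimes> inv (r g)) \<otimes> (q h \<otimes> inv (r h))" .
qed (use q r in auto)

text \<open>The factor \<open>e\<close> contributes e(gh) / (e(g) e(h)) = 1 to the polarization. The
  relation between \<open>q\<close> and \<open>r\<close> is assumed only on the carrier, where their
  values are meaningful.\<close>

lemma (in comm_group) polarization_mult_hom:
  fixes H (structure)
  assumes r: "r \<in> carrier H \<rightarrow> carrier G" and e: "e \<in> hom H G" and H: "monoid H"
    and q: "\<And>g. g \<in> carrier H \<Longrightarrow> q g = r g \<otimes> e g"
    and gh: "g \<in> carrier H" "h \<in> carrier H"
  shows "polarization H G q g h = polarization H G r g h"
proof -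
  have m: "g \<otimes>\<^bsub>H\<^esub> h \<in> carrier H"
    using monoid.m_closed[OF H gh] .
  have c: "r g \<in> carrier G" "r h \<in> carrier G" "r (g \<otimes>\<^bsub>H\<^esub> h) \<in> carrier G"
      "e g \<in> carrier G" "e h \<in> carrier G"
    using r e gh m by (auto simp: hom_def)
  have "polarization H G q g h
      = (r (g \<otimes>\<^bsub>H\<^esub> h) \<otimes> (e g \<otimes> e h)) \<otimes> inv (r g \<otimes> e g) \<otimes> inv (r h \<otimes> e h)"
    using gh m q hom_mult[OF e gh] by (simp add: polarization_def)
  \<comment> \<open>All values of \<open>e\<close> are gathered into two cancelling pairs.\<close>
  also have "\<dots> = (r (g \<otimes>\<^bsub>H\<^esub> h) \<otimes> inv (r g) \<otimes> inv (r h))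
      \<otimes> ((e g \<otimes> inv (e g)) \<otimes> (e h \<otimes> inv (e h)))"
    using c by (simp only: inv_mult m_ac inv_closed m_closed)
  also have "\<dots> = polarization H G r g h"
    using c by (simp add: polarization_def)
  finally show ?thesis .
qed

text \<open>Invariance under inversion gives e(g)^2 = e(g g^{-1}) = 1, that is (e(g) - 1)(e(g) + 1)
  = 0; without zero divisors, one factor vanishes.\<close>

lemma (in domain) hom_sign_group:
  fixes H (structure)
  assumes e: "e \<in> hom H (units_of R)" and H: "group H"
    and inv: "\<And>g. g \<in> carrier H \<Longrightarrow> e (inv\<^bsub>H\<^esub> g) = e g"
  shows "e \<in> hom H (sign_group R)"
proof (rule homI)
  fix g assume g: "g \<in> carrier H"
  interpret H: group H by (rule H)
  interpret U: group "units_of R" by (rule units_group)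
  have eg: "e g \<in> carrier R"
    using e g by (auto simp: hom_def units_of_def)
  have "e g \<otimes>\<^bsub>R\<^esub> e g = e (g \<otimes>\<^bsub>H\<^esub> inv\<^bsub>H\<^esub> g)"
    using hom_mult[OF e g H.inv_closed[OF g]] inv[OF g] by (simp add: units_of_def)
  also have "\<dots> = \<one>\<^bsub>R\<^esub>"
    using g hom_one[OF e H.is_group U.is_group] by (simp add: units_of_def)
  finally have "e g = \<one>\<^bsub>R\<^esub> \<or> e g = \<ominus>\<^bsub>R\<^esub> \<one>\<^bsub>R\<^esub>"
    by (rule square_eq_one[OF eg])
  then show "e g \<in> carrier (sign_group R)"
    by (simp add: sign_group_def)
next
  \<comment> \<open>\<open>sign_group R\<close> changes only the carrier of
    \<open>units_of R\<close>, so multiplicativity is inherited.\<close>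
  fix g h assume "g \<in> carrier H" "h \<in> carrier H"
  then show "e (g \<otimes>\<^bsub>H\<^esub> h) = e g \<otimes>\<^bsub>sign_group R\<^esub> e h"
    using hom_mult[OF e] by (simp add: sign_group_def)
qed

theorem lemma4p2p11:
  fixes K :: "('b, 'n) ring_scheme"
    and G :: "('a, 'm) monoid_scheme"
    and q\<^sub>0 q\<^sub>1 :: "'a \<Rightarrow> 'b"
    and g\<^sub>0 g\<^sub>1 :: 'a
  assumes "field K"
    and "comm_group G" and "finite (carrier G)"
    and "g\<^sub>0 \<in> carrier G" and "g\<^sub>1 \<in> carrier G"
    and "weak_quadratic_form G (units_of K) q\<^sub>0" and "symmetric_wrt G g\<^sub>0 q\<^sub>0"
    and "weak_quadratic_form G (units_of K) q\<^sub>1" and "symmetric_wrt G g\<^sub>1 q\<^sub>1"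
  shows "((\<forall>g \<in> carrier G. \<forall>h \<in> carrier G.
            polarization G (units_of K) q\<^sub>0 g h = polarization G (units_of K) q\<^sub>1 g h) \<longrightarrow>
          (\<exists>\<eta> \<in> hom G (units_of K).
            (\<forall>g \<in> carrier G. q\<^sub>0 g = q\<^sub>1 g \<otimes>\<^bsub>K\<^esub> \<eta> g) \<and>
            (g\<^sub>0 = \<one>\<^bsub>G\<^esub> \<and> g\<^sub>1 = \<one>\<^bsub>G\<^esub> \<longrightarrow> \<eta> \<in> hom G (sign_group K))))
       \<and> ((\<exists>\<eta> \<in> hom G (units_of K). \<forall>g \<in> carrier G. q\<^sub>0 g = q\<^sub>1 g \<otimes>\<^bsub>K\<^esub> \<eta> g) \<longrightarrow>
          (\<forall>g \<in> carrier G. \<forall>h \<in> carrier G.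
            polarization G (units_of K) q\<^sub>0 g h = polarization G (units_of K) q\<^sub>1 g h))"
proof -
  interpret K: field K by fact
  interpret G: comm_group G by fact
  interpret U: comm_group "units_of K" by (rule K.units_comm_group)
  have q0: "q\<^sub>0 \<in> carrier G \<rightarrow> carrier (units_of K)"
    and q1: "q\<^sub>1 \<in> carrier G \<rightarrow> carrier (units_of K)"
    using assms(6,8) by (auto simp: weak_quadratic_form_def)
  \<comment> \<open>The quotient is taken inside \<open>units_of K\<close>, so that the lemmas on
    commutative groups apply to it; \<open>units_of_mult\<close> later translates products back to
    \<open>K\<close>.\<close>
  define \<eta> where "\<eta> g = q\<^sub>0 g \<otimes>\<^bsub>units_of K\<^esub> inv\<^bsub>units_of K\<^esub> q\<^sub>1 g" for g
  show ?thesis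
  proof (intro conjI impI)
    assume eq: "\<forall>g \<in> carrier G. \<forall>h \<in> carrier G.
      polarization G (units_of K) q\<^sub>0 g h = polarization G (units_of K) q\<^sub>1 g h"
    have hom: "\<eta> \<in> hom G (units_of K)"
      unfolding \<eta>_def using U.quotient_hom_if_polarization_eq[OF q0 q1 G.is_monoid] eq by blast
    have "q\<^sub>0 g = q\<^sub>1 g \<otimes>\<^bsub>K\<^esub> \<eta> g" if "g \<in> carrier G" for g
    proof -
      have c: "q\<^sub>0 g \<in> carrier (units_of K)" "q\<^sub>1 g \<in> carrier (units_of K)"
        using q0 q1 that by auto
      have "q\<^sub>1 g \<otimes>\<^bsub>units_of K\<^esub> \<eta> g
          = q\<^sub>0 g \<otimes>\<^bsub>units_of K\<^esub> (q\<^sub>1 g \<otimes>\<^bsub>units_of K\<^esub> inv\<^bsub>units_of K\<^esub> q\<^sub>1 g)"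
        unfolding \<eta>_def using c by (simp only: U.m_ac U.inv_closed U.m_closed)
      also have "\<dots> = q\<^sub>0 g"
        using c by (simp only: U.r_inv U.r_one)
      finally show ?thesis
        by (simp add: units_of_mult)
    qed
    moreover have "\<eta> \<in> hom G (sign_group K)" if "g\<^sub>0 = \<one>\<^bsub>G\<^esub> \<and> g\<^sub>1 = \<one>\<^bsub>G\<^esub>"
    proof (rule K.hom_sign_group[OF hom G.is_group])
      fix g assume g: "g \<in> carrier G"
      \<comment> \<open>With both base points equal to 1, symmetry says that each form takes equal
        values at g and its inverse, and the quotient inherits this.\<close>
      have "q\<^sub>0 g = q\<^sub>0 (inv\<^bsub>G\<^esub> g \<otimes>\<^bsub>G\<^esub> \<one>\<^bsub>G\<^esub>)" "q\<^sub>1 g = q\<^sub>1 (inv\<^bsub>G\<^esub> g \<otimes>\<^bsub>G\<^esub> \<one>\<^bsub>G\<^esub>)"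
        using assms(7,9) that g unfolding symmetric_wrt_def by blast+
      then show "\<eta> (inv\<^bsub>G\<^esub> g) = \<eta> g"
        using g by (simp add: \<eta>_def)
    qed
    ultimately show "\<exists>\<eta> \<in> hom G (units_of K).
        (\<forall>g \<in> carrier G. q\<^sub>0 g = q\<^sub>1 g \<otimes>\<^bsub>K\<^esub> \<eta> g) \<and>
        (g\<^sub>0 = \<one>\<^bsub>G\<^esub> \<and> g\<^sub>1 = \<one>\<^bsub>G\<^esub> \<longrightarrow> \<eta> \<in> hom G (sign_group K))"
      using hom by blast
  next
    assume "\<exists>\<eta> \<in> hom G (units_of K). \<forall>g \<in> carrier G. q\<^sub>0 g = q\<^sub>1 g \<otimes>\<^bsub>K\<^esub> \<eta> g"
    then show "\<forall>g \<in> carrier G. \<forall>h \<in> carrier G.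
        polarization G (units_of K) q\<^sub>0 g h = polarization G (units_of K) q\<^sub>1 g h"
      using U.polarization_mult_hom[OF q1 _ G.is_monoid, of _ q\<^sub>0] by (auto simp: units_of_mult)
  qed
qed

end
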